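(* Let $R$ be a numerical semigroup ring and let $A$ be a minimal homogeneous presentation matrix for the conductor ideal $\mathfrak{c}_R$ of $R$. Then $\operatorname{tr}_R(\Omega^1_R(\mathfrak{c}_R))=I_1(A)$, and the following are equivalent: (1) $\operatorname{tr}_R(\Omega^1_R(\mathfrak{c}_R))=\mathfrak{c}_R$. (2) $R$ is not a DVR and, for some integer $s$, $R=k[t^{a_1},t^{sa_1+1},t^{sa_1+2},\dots,t^{sa_1+a_1-1}]$.
   Context: A numerical semigroup ring is $R=k[t^{a_1},\dots,t^{a_n}]$ (or its power series version $k[\![t^{a_1},\dots,t^{a_n}]\!]$, to be read correspondingly in (2); the graded version is the one worked with), where $k$ is a field and $a_1<\cdots<a_n$ are the minimal generators of a numerical semigroup (so $\gcd(a_1,\dots,a_n)=1$). $R$ is graded with $t$ in degree $1$ and $\mathfrak{m}=(t^{a_1},\dots,t^{a_n})$. "$R$ is a DVR" means $a_1=1$, i.e. $R=k[t]$ (respectively $k[\![t]\!]$). $\mathfrak{c}_R=(R:_{Q(R)}\overline{R})$ is the conductor ideal, where $\overline{R}$ is the integral closure of $R$ in its total quotient ring $Q(R)$. The trace ideal of an $R$-module $M$ is $\operatorname{tr}_R(M)=\langle f(x)\mid f\in\operatorname{Hom}_R(M,R),\ x\in M\rangle$. $\Omega^1_R(M)$ is the first syzygy of $M$, i.e. the kernel of a surjection from a free module onto $M$ given by a minimal homogeneous generating set. A minimal homogeneous presentation matrix of $M$ is the matrix $A$ in a minimal graded presentation $R^{\oplus q}\xrightarrow{A}R^{\oplus p}\to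 M\to 0$, and $I_1(A)$ is the ideal generated by the entries of $A$ (zero if $A$ has no columns). *)

theory Defs
  imports
    "HOL-Computational_Algebra.Computational_Algebra"
    "Jordan_Normal_Form.Matrix"
begin

(* Everything takes place in the rational function field k(t), represented by the type
   'k poly fract.  Rings and ideals are subsets of it; submodules of a free module R^p
   are subsets of carrier_vec p. *)

definition const_fract :: "'k::field \<Rightarrow> 'k poly fract" where
  "const_fract c = to_fract [:c:]"

definition t_fract :: "'k::field poly fract" where
  "t_fract = to_fract [:0, 1:]"

definition add_submonoid :: "nat set \<Rightarrow> bool" where
  "add_submonoid T \<longleftrightarrow> 0 \<in> T \<and> (\<forall>x\<in>T. \<forall>y\<in>T. x + y \<in> T)"

(* as lists, in increasing order, the minimal generators of a numerical semigroup.
   The last conjunct forces all of them to be positive. *)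
definition numerical_semigroup_gens :: "nat list \<Rightarrow> bool" where
  "numerical_semigroup_gens as \<longleftrightarrow>
     sorted_wrt (<) as \<and> Gcd (set as) = 1 \<and>
     (\<forall>a\<in>set as. a \<notin> add_submonoid hull (set as - {a}))"

definition subalgebra_fract :: "'k::field poly fract set \<Rightarrow> bool" where
  "subalgebra_fract T \<longleftrightarrow>
     range const_fract \<subseteq> T \<and> (\<forall>x\<in>T. \<forall>y\<in>T. x + y \<in> T \<and> x * y \<in> T)"

definition k_adjoin :: "'k::field poly fract set \<Rightarrow> 'k poly fract set" where
  "k_adjoin X = subalgebra_fract hull X"

definition numerical_semigroup_ring :: "nat list \<Rightarrow> 'k::field poly fract set" where
  "numerical_semigroup_ring as = k_adjoin ((\<lambda>a. t_fract ^ a) ` set as)"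

(* R is a subring of a field, hence a domain, and its total quotient
   ring is formed inside that field. *)

definition total_quotient_ring :: "'a::field set \<Rightarrow> 'a set" where
  "total_quotient_ring R = {a / b | a b. a \<in> R \<and> b \<in> R \<and> b \<noteq> 0}"

definition integral_closure :: "'a::field set \<Rightarrow> 'a set" where
  "integral_closure R =
     {x \<in> total_quotient_ring R.
        \<exists>p. lead_coeff p = 1 \<and> (\<forall>i. coeff p i \<in> R) \<and> poly p x = 0}"

definition conductor :: "'a::field set \<Rightarrow> 'a set" where
  "conductor R = {x \<in> total_quotient_ring R. \<forall>y\<in>integral_closure R. x * y \<in> R}"

definition is_ideal :: "'a::comm_ring_1 set \<Rightarrow> 'a set \<Rightarrow> bool" where
  "is_ideal R I \<longleftrightarrow>
     I \<subseteq> R \<and> 0 \<in> I \<and> (\<forall>x\<in>I. \<forall>y\<in>I. x + y \<in> I) \<and> (\<forall>r\<in>R. \<forall>x\<in>I. r * x \<in> I)"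

definition ideal_generated :: "'a::comm_ring_1 set \<Rightarrow> 'a set \<Rightarrow> 'a set" where
  "ideal_generated R X = is_ideal R hull X"

(* Hom_R(M, R) for an R-module M with carrier in 'm and scalar multiplication sc;
   the values of f outside M are irrelevant. *)
definition dual_module ::
    "'a::comm_ring_1 set \<Rightarrow> ('a \<Rightarrow> 'm::plus \<Rightarrow> 'm) \<Rightarrow> 'm set \<Rightarrow> ('m \<Rightarrow> 'a) set" where
  "dual_module R sc M =
     {f. (\<forall>x\<in>M. f x \<in> R) \<and> (\<forall>x\<in>M. \<forall>y\<in>M. f (x + y) = f x + f y) \<and>
         (\<forall>r\<in>R. \<forall>x\<in>M. f (sc r x) = r * f x)}"

definition trace_ideal ::
    "'a::comm_ring_1 set \<Rightarrow> ('a \<Rightarrow> 'm::plus \<Rightarrow> 'm) \<Rightarrow> 'm set \<Rightarrow> 'a set" where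
  "trace_ideal R sc M = ideal_generated R {f x | f x. f \<in> dual_module R sc M \<and> x \<in> M}"

(* I_1(A) *)
definition entry_ideal :: "'a::comm_ring_1 set \<Rightarrow> 'a mat \<Rightarrow> 'a set" where
  "entry_ideal R A = ideal_generated R (elements_mat A)"

definition homogeneous :: "int \<Rightarrow> 'k::field poly fract \<Rightarrow> bool" where
  "homogeneous d x \<longleftrightarrow> (\<exists>c. x = const_fract c * t_fract powi d)"

definition free_module :: "'a set \<Rightarrow> nat \<Rightarrow> 'a vec set" where
  "free_module R p = {x \<in> carrier_vec p. \<forall>i<p. x $ i \<in> R}"

(* The entries of g, of degrees d 0, d 1, ..., generate the R-submodule M of k(t), and
   no entry can be omitted.  Then x \<mapsto> g \<bullet> x is a surjection from the free
   module of rank dim_vec g onto M. *)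
definition min_homogeneous_gens ::
    "'k::field poly fract set \<Rightarrow> 'k poly fract set \<Rightarrow> 'k poly fract vec \<Rightarrow> (nat \<Rightarrow> int) \<Rightarrow> bool"
  where
  "min_homogeneous_gens R M g d \<longleftrightarrow>
     (\<forall>i<dim_vec g. homogeneous (d i) (g $ i)) \<and>
     M = {g \<bullet> x | x. x \<in> free_module R (dim_vec g)} \<and>
     (\<forall>i<dim_vec g. M \<noteq> {g \<bullet> x | x. x \<in> free_module R (dim_vec g) \<and> x $ i = 0})"

definition syzygies :: "'a::comm_ring_1 set \<Rightarrow> 'a vec \<Rightarrow> 'a vec set" where
  "syzygies R g = {x \<in> free_module R (dim_vec g). g \<bullet> x = 0}"

(* N is a first syzygy module of M; it is determined up to isomorphism only. *)
definition is_first_syzygy ::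
    "'k::field poly fract set \<Rightarrow> 'k poly fract set \<Rightarrow> 'k poly fract vec set \<Rightarrow> bool" where
  "is_first_syzygy R M N \<longleftrightarrow> (\<exists>g d. min_homogeneous_gens R M g d \<and> N = syzygies R g)"

(* A is the matrix in a minimal graded presentation
     R^q --A--> R^p --g--> M --> 0,
   where the j-th basis vector of R^q has degree e j and the i-th one of R^p has degree
   d i: the columns of A are homogeneous, generate the kernel of g, and none of them can
   be omitted. *)
definition min_homogeneous_presentation ::
    "'k::field poly fract set \<Rightarrow> 'k poly fract set \<Rightarrow> 'k poly fract mat \<Rightarrow> bool" where
  "min_homogeneous_presentation R M A \<longleftrightarrow>
     (\<exists>g d e. min_homogeneous_gens R M g d \<and> dim_row A = dim_vec g \<and>
        elements_mat A \<subseteq> R \<and>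
        (\<forall>i<dim_row A. \<forall>j<dim_col A. homogeneous (e j - d i) (A $$ (i, j))) \<and>
        syzygies R g = {A *\<^sub>v x | x. x \<in> free_module R (dim_col A)} \<and>
        (\<forall>j<dim_col A.
           syzygies R g \<noteq> {A *\<^sub>v x | x. x \<in> free_module R (dim_col A) \<and> x $ j = 0}))"

end

theory Submission
  imports Defs
begin

text \<open>
Let \<open>H\<close> be the numerical semigroup, \<open>e\<close> its least positive element and \<open>c\<close> its conductor, so that
\<open>R\<close> consists of the polynomials supported in \<open>H\<close> and the conductor ideal is \<open>t^c k[t]\<close>.
Every ideal in sight is spanned by monomials, and each claim becomes a claim about exponents.

The minimal homogeneous generators of \<open>t^c k[t]\<close> over \<open>R\<close> are, up to order and units of \<open>k\<close>,
\<open>t^c, ..., t^(c+e-1)\<close> (\<open>conductor_generatorsE\<close>).  A homogeneous syzygy needs at least two nonzero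
components to cancel, and the two exponents then differ by the difference of two of these \<open>e\<close>
consecutive degrees.  Hence the exponents that occur in components of syzygies are the
\<open>crowded\<close> elements: those \<open>h\<close> in \<open>H\<close> for which \<open>H\<close> contains another element at distance less than \<open>e\<close>.
Binomial syzygies realise all of them, so \<open>I_1(A)\<close> is the span of the crowded monomials.

The coordinate functions show that the trace ideal contains \<open>I_1(A)\<close>.  For the converse, a homomorphism
\<open>f\<close> from the syzygy module to \<open>R\<close> need not extend to a map from the free module to \<open>R\<close>, but it does
extend to a map into \<open>k[t]\<close> (\<open>homomorphism_extends\<close>): \<open>f x\<close> is the sum of the \<open>x_i Q_i\<close> with
polynomials \<open>Q_i\<close>.  An exponent of \<open>f x\<close> is therefore \<open>h + q\<close> with \<open>h\<close> an exponent of some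
\<open>x_i\<close> and \<open>q \<ge> 0\<close> one of \<open>Q_i\<close>.  If the generator with index \<open>i\<close> has degree \<open>n_i\<close>, then among the numbers
\<open>q + l - n_i\<close>, where \<open>l\<close> runs through the \<open>e\<close> generator degrees, one is a
nonnegative multiple of \<open>e\<close>, so lies in \<open>H\<close>.  Adding \<open>h\<close> gives an element of \<open>H\<close> at distance less than \<open>e\<close> from
\<open>h + q\<close>.  If it is \<open>h + q\<close> itself, then \<open>q\<close> lies in \<open>H\<close>, and the term of the syzygy cancelling \<open>t^h\<close> provides a
neighbour instead (\<open>homomorphism_value_crowded\<close>).

Finally, the crowded elements are exactly those \<open>\<ge> c\<close> if and only if \<open>e > 1\<close> and all elements of \<open>H\<close>
below \<open>c\<close> are multiples of \<open>e\<close>, with \<open>c\<close> itself a multiple of \<open>e\<close>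
(\<open>crowded_eq_conductor_iff\<close>).  This is the second condition of the theorem.
\<close>

(* The sign $ is the indexing of vectors throughout. *)
no_notation fps_nth (infixl "$" 75)

section \<open>Spans of monomials in the rational function field\<close>

lemma to_fract_power: "to_fract (p ^ n) = to_fract p ^ n"
  by (induction n) simp_all

lemma t_fract_power: "t_fract ^ n = (to_fract (monom 1 n) :: 'k::field poly fract)"
  by (simp add: t_fract_def monom_altdef to_fract_power)

lemma to_fract_monom: "to_fract (monom a n) = const_fract a * t_fract ^ n"
  unfolding t_fract_power const_fract_def to_fract_mult[symmetric]
  by (simp add: smult_monom)

lemma t_fract_nonzero [simp]: "t_fract \<noteq> 0"
  by (simp add: t_fract_def)

lemma const_fract_simps [simp]:
  "const_fract 0 = 0" "const_fract 1 = 1" "const_fract a = 0 \<longleftrightarrow> a = 0"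
  "const_fract (a * b) = const_fract a * const_fract b"
  "const_fract (a + b) = const_fract a + const_fract b"
  "const_fract (- a) = - const_fract a"
  unfolding const_fract_def to_fract_mult[symmetric] to_fract_add[symmetric]
    to_fract_uminus[symmetric] to_fract_eq_iff
  by (simp_all add: one_pCons[symmetric])

definition monomial_span :: "nat set \<Rightarrow> 'k::field poly fract set" where
  "monomial_span S = to_fract ` {p. \<forall>n. coeff p n \<noteq> 0 \<longrightarrow> n \<in> S}"

lemma to_fract_mem_monomial_span:
  "to_fract p \<in> monomial_span S \<longleftrightarrow> (\<forall>n. coeff p n \<noteq> 0 \<longrightarrow> n \<in> S)"
  by (auto simp: monomial_span_def)

lemma monomial_spanE:
  assumes "x \<in> monomial_span S"
  obtains p where "x = to_fract p" "\<And>n. coeff p n \<noteq> 0 \<Longrightarrow> n \<in> S"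
  using assms by (auto simp: monomial_span_def)

lemma monomial_mem_monomial_span:
  "const_fract a * t_fract ^ n \<in> monomial_span S \<longleftrightarrow> a = 0 \<or> n \<in> S"
  unfolding to_fract_monom[symmetric] to_fract_mem_monomial_span by auto

lemma t_power_mem_monomial_span [simp]: "t_fract ^ n \<in> monomial_span S \<longleftrightarrow> n \<in> S"
  using monomial_mem_monomial_span[of 1 n S] by simp

lemma const_mem_monomial_span: "0 \<in> S \<Longrightarrow> const_fract a \<in> monomial_span S"
  using monomial_mem_monomial_span[of a 0 S] by simp

lemma one_mem_monomial_span: "0 \<in> S \<Longrightarrow> 1 \<in> monomial_span S"
  using const_mem_monomial_span[of S 1] by simp

lemma zero_mem_monomial_span [simp]: "0 \<in> monomial_span S"
  using to_fract_mem_monomial_span[of 0 S] by simp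

lemma add_mem_monomial_span:
  "x \<in> monomial_span S \<Longrightarrow> y \<in> monomial_span S \<Longrightarrow> x + y \<in> monomial_span S"
proof (elim monomial_spanE)
  fix p q assume pq: "x = to_fract p" "y = to_fract q"
    "\<And>n. coeff p n \<noteq> 0 \<Longrightarrow> n \<in> S" "\<And>n. coeff q n \<noteq> 0 \<Longrightarrow> n \<in> S"
  have "n \<in> S" if "coeff (p + q) n \<noteq> 0" for n
    using that pq(3,4)[of n] by (cases "coeff p n = 0") auto
  then show "x + y \<in> monomial_span S"
    unfolding pq(1,2) to_fract_add[symmetric] to_fract_mem_monomial_span by blast
qed

lemma mult_mem_monomial_span:
  assumes "x \<in> monomial_span S" "y \<in> monomial_span T"
    and ST: "\<forall>a\<in>S. \<forall>b\<in>T. a + b \<in> U"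
  shows "x * y \<in> monomial_span U"
proof -
  from assms obtain p q where pq: "x = to_fract p" "y = to_fract q"
    "\<And>n. coeff p n \<noteq> 0 \<Longrightarrow> n \<in> S" "\<And>n. coeff q n \<noteq> 0 \<Longrightarrow> n \<in> T"
    by (metis monomial_spanE)
  have "n \<in> U" if "coeff (p * q) n \<noteq> 0" for n
  proof -
    from that obtain i where "i \<le> n" "coeff p i * coeff q (n - i) \<noteq> 0"
      unfolding coeff_mult by (meson atMost_iff sum.neutral)
    then have "i \<in> S" "n - i \<in> T" using pq(3)[of i] pq(4)[of "n - i"] by auto
    then have "i + (n - i) \<in> U" using ST by blast
    then show ?thesis using \<open>i \<le> n\<close> by simp
  qed
  then show ?thesis
    unfolding pq(1,2) to_fract_mult[symmetric] to_fract_mem_monomial_span by blast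
qed

lemma sum_mem:
  assumes "0 \<in> T" "\<And>x y. x \<in> T \<Longrightarrow> y \<in> T \<Longrightarrow> x + y \<in> T"
    and "\<And>i. i \<in> B \<Longrightarrow> F i \<in> T"
  shows "sum F B \<in> T"
  using assms(3) by (induction B rule: infinite_finite_induct) (auto intro: assms(1,2))

lemma monomial_span_subset:
  fixes T :: "'k::field poly fract set"
  assumes "0 \<in> T" "\<And>x y. x \<in> T \<Longrightarrow> y \<in> T \<Longrightarrow> x + y \<in> T"
    and gen: "\<And>a n. n \<in> S \<Longrightarrow> const_fract a * t_fract ^ n \<in> T"
  shows "monomial_span S \<subseteq> T"
proof
  fix x :: "'k poly fract" assume "x \<in> monomial_span S"
  then obtain p where p: "x = to_fract p" "\<And>n. coeff p n \<noteq> 0 \<Longrightarrow> n \<in> S"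
    by (metis monomial_spanE)
  have "x = (\<Sum>i\<le>degree p. to_fract (monom (coeff p i) i))"
    unfolding p(1) to_fract_sum[symmetric] poly_as_sum_of_monoms ..
  also have "\<dots> \<in> T"
  proof (rule sum_mem[OF assms(1,2)])
    show "to_fract (monom (coeff p i) i) \<in> T" for i
      using p(2)[of i] gen[of i "coeff p i"] \<open>0 \<in> T\<close>
      by (cases "coeff p i = 0") (simp_all add: to_fract_monom)
  qed
  finally show "x \<in> T" .
qed

lemma monomial_span_eq_iff:
  "monomial_span S = (monomial_span T :: 'k::field poly fract set) \<longleftrightarrow> S = T"
proof
  assume "monomial_span S = (monomial_span T :: 'k poly fract set)"
  then have "(t_fract :: 'k poly fract) ^ n \<in> monomial_span S \<longleftrightarrow> (t_fract :: 'k poly fract) ^ n \<in> monomial_span T" for n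
    by simp
  then show "S = T" by auto
qed simp

lemma monomial_span_subset_polys: "monomial_span S \<subseteq> range to_fract"
  by (auto simp: monomial_span_def)

text \<open>
Degrees of homogeneous elements are integers a priori; the next two lemmas turn the degree of
a nonzero homogeneous polynomial into a natural number.
\<close>

lemma negative_power_not_poly:
  assumes "m > 0"
  shows "inverse (t_fract ^ m) \<notin> range (to_fract :: 'k::field poly \<Rightarrow> _)"
proof
  assume "inverse (t_fract ^ m) \<in> range (to_fract :: 'k poly \<Rightarrow> _)"
  then obtain p :: "'k poly" where "inverse (t_fract ^ m) = to_fract p" by auto
  then have "to_fract (p * monom 1 m) = to_fract 1"
    unfolding to_fract_mult t_fract_power[symmetric] by (metis left_inverse t_fract_nonzero power_not_zero to_fract_1)
  then have "coeff (monom 1 m * p) 0 = 1" by (simp only: to_fract_eq_iff mult.commute coeff_1) simp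
  with assms show False by (simp add: coeff_monom_mult)
qed

lemma homogeneous_mem_monomial_span:
  assumes "const_fract a * t_fract powi d \<in> monomial_span S" "a \<noteq> 0"
  shows "d \<ge> 0 \<and> nat d \<in> S"
proof (cases "d \<ge> 0")
  case True
  then show ?thesis
    using assms monomial_mem_monomial_span[of a "nat d" S] by (simp add: power_int_def)
next
  case False
  let ?y = "inverse (t_fract ^ nat (- d)) :: 'a poly fract"
  from assms obtain p where p: "const_fract a * ?y = to_fract p"
    using False by (auto simp: power_int_def power_inverse elim: monomial_spanE)
  have "?y = const_fract (1 / a) * (const_fract a * ?y)"
    using assms(2) by (simp add: mult.assoc[symmetric] const_fract_simps(4)[symmetric] del: const_fract_simps(4))
  also have "\<dots> = to_fract ([:1 / a:] * p)"
    unfolding p unfolding const_fract_def by (rule to_fract_mult[symmetric])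
  finally show ?thesis
    using negative_power_not_poly[of "nat (- d)"] False by auto
qed

section \<open>Monomial algebras and ideals\<close>

lemma add_submonoid_hull: "add_submonoid (add_submonoid hull G)"
  by (rule hull_in) (auto simp: add_submonoid_def)

lemma submonoid_mult:
  assumes "add_submonoid M" "a \<in> M" shows "m * a \<in> M"
  using assms by (induction m) (auto simp: add_submonoid_def)

lemma k_adjoin_monomials:
  "k_adjoin ((\<lambda>a. t_fract ^ a) ` G) = (monomial_span (add_submonoid hull G) :: 'k::field poly fract set)"
  (is "_ = monomial_span ?H")
  unfolding k_adjoin_def
proof (rule hull_unique)
  show "(\<lambda>a. t_fract ^ a) ` G \<subseteq> (monomial_span ?H :: 'k poly fract set)"
    by (auto intro: hull_inc)
  have "const_fract a \<in> monomial_span ?H" for a :: 'k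
    using add_submonoid_hull[of G] by (simp add: add_submonoid_def const_mem_monomial_span)
  then show "subalgebra_fract (monomial_span ?H :: 'k poly fract set)"
    unfolding subalgebra_fract_def
    using add_submonoid_hull[of G] mult_mem_monomial_span[of _ ?H _ ?H ?H] add_mem_monomial_span
    by (auto simp: add_submonoid_def)
next
  fix T :: "'k poly fract set"
  assume T: "(\<lambda>a. t_fract ^ a) ` G \<subseteq> T" "subalgebra_fract T"
  then have c: "const_fract a \<in> T" for a by (auto simp: subalgebra_fract_def)
  have "add_submonoid {n. t_fract ^ n \<in> T}"
    using T(2) c[of 1] by (auto simp: add_submonoid_def subalgebra_fract_def power_add)
  then have H: "t_fract ^ n \<in> T" if "n \<in> ?H" for n
    using hull_induct[OF that, of "\<lambda>n. t_fract ^ n \<in> T"] T(1) by auto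
  show "monomial_span ?H \<subseteq> T"
  proof (rule monomial_span_subset)
    show "0 \<in> T" using c[of 0] by simp
    show "\<And>x y. x \<in> T \<Longrightarrow> y \<in> T \<Longrightarrow> x + y \<in> T"
      using T(2) by (simp add: subalgebra_fract_def)
    show "\<And>a n. n \<in> ?H \<Longrightarrow> const_fract a * t_fract ^ n \<in> T"
      using T(2) c H by (simp add: subalgebra_fract_def)
  qed
qed

text \<open>
The criterion by which both the trace ideal and the entry ideal are computed.
\<close>

lemma ideal_generated_eq_monomial_span:
  assumes "X \<subseteq> monomial_span J" "J \<subseteq> H" "\<forall>a\<in>H. \<forall>b\<in>J. a + b \<in> J"
    and "0 \<in> H"
    and "\<And>I h. is_ideal (monomial_span H) I \<Longrightarrow> X \<subseteq> I \<Longrightarrow> h \<in> J \<Longrightarrow> t_fract ^ h \<in> I"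
  shows "ideal_generated (monomial_span H) X = (monomial_span J :: 'k::field poly fract set)"
  unfolding ideal_generated_def
proof (rule hull_unique)
  have "monomial_span J \<subseteq> (monomial_span H :: 'k poly fract set)"
    using assms(2) by (auto simp: monomial_span_def)
  then show "is_ideal (monomial_span H) (monomial_span J :: 'k poly fract set)"
    using mult_mem_monomial_span[OF _ _ assms(3)] add_mem_monomial_span
    unfolding is_ideal_def by (metis zero_mem_monomial_span)
next
  fix I :: "'k poly fract set"
  assume X: "X \<subseteq> I" and I: "is_ideal (monomial_span H) I"
  show "monomial_span J \<subseteq> I"
  proof (rule monomial_span_subset)
    show "0 \<in> I" "\<And>x y. x \<in> I \<Longrightarrow> y \<in> I \<Longrightarrow> x + y \<in> I"
      using I by (simp_all add: is_ideal_def)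
    fix a :: 'k and n assume "n \<in> J"
    then have "t_fract ^ n \<in> I" by (rule assms(5)[OF I X])
    moreover have "const_fract a \<in> monomial_span H"
      using assms(4) by (rule const_mem_monomial_span)
    ultimately show "const_fract a * t_fract ^ n \<in> I"
      using I by (simp add: is_ideal_def)
  qed
qed (fact assms(1))

section \<open>Integral elements over the polynomial ring\<close>

text \<open>
The integral closure is bounded by a degree argument that avoids greatest common divisors.  Modulo \<open>k[t]\<close>,
an element may be assumed to be a fraction \<open>y\<close> of negative degree, and its powers still have the
common denominator \<open>d\<close>.  For large \<open>m\<close> the polynomial \<open>d * y^m\<close> would have negative degree, so \<open>y = 0\<close>.
\<close>

lemma almost_integral_over_poly:
  fixes x :: "'k::field poly fract"
  assumes "d \<noteq> 0" and int: "\<And>m. to_fract d * x ^ m \<in> range to_fract"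
  shows "x \<in> range to_fract"
proof -
  obtain a b where x: "x = to_fract a / to_fract b" and b: "b \<noteq> 0"
    by (cases x) (auto simp: Fract_conv_to_fract)
  define r where "r = a mod b"
  define y where "y = to_fract r / to_fract b"
  have "x = y + to_fract (a div b)"
  proof -
    have "to_fract a = to_fract (a div b) * to_fract b + to_fract r"
      unfolding r_def to_fract_mult[symmetric] to_fract_add[symmetric] by simp
    then show ?thesis using b by (simp add: x y_def field_simps)
  qed
  then have y: "y = x + to_fract (- (a div b))" by simp
  have poly: "to_fract d * y ^ m \<in> range to_fract" for m
  proof -
    have "to_fract d * y ^ m = (\<Sum>k\<le>m. of_nat (m choose k) * (to_fract d * x ^ k) * to_fract (- (a div b)) ^ (m - k))"
      unfolding y binomial_ring sum_distrib_left by (simp add: mult_ac)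
    also have "\<dots> \<in> range to_fract"
    proof (rule sum_mem)
      show "(0::'k poly fract) \<in> range to_fract" by (metis rangeI to_fract_0)
      show "u + v \<in> range to_fract" if "u \<in> range to_fract" "v \<in> range to_fract" for u v :: "'k poly fract"
        using that by (auto simp flip: to_fract_add)
      fix k
      obtain z where z: "to_fract d * x ^ k = to_fract z" using int[of k] by auto
      have "of_nat j = (to_fract (of_nat j) :: 'k poly fract)" for j
        by (induction j) simp_all
      then show "of_nat (m choose k) * (to_fract d * x ^ k) * to_fract (- (a div b)) ^ (m - k) \<in> range to_fract"
        unfolding z by (metis rangeI to_fract_mult to_fract_power)
    qed
    finally show ?thesis .
  qed
  have "r = 0"
  proof (rule ccontr)
    assume r: "r \<noteq> 0"
    then have less: "degree r < degree b" unfolding r_def using b degree_mod_less by blast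
    (* Each factor y lowers the degree by at least one, so this power exhausts the degree of d. *)
    let ?m = "Suc (degree d)"
    obtain z where "to_fract d * y ^ ?m = to_fract z" using poly[of ?m] by auto
    then have "to_fract (d * r ^ ?m) = to_fract (z * b ^ ?m)"
      using b unfolding to_fract_mult to_fract_power y_def by (simp add: field_simps)
    then have eq: "d * r ^ ?m = z * b ^ ?m" by (simp only: to_fract_eq_iff)
    then have "z \<noteq> 0" using r \<open>d \<noteq> 0\<close> by auto
    have "degree (d * r ^ ?m) = degree d + ?m * degree r"
      using r \<open>d \<noteq> 0\<close> by (simp add: degree_mult_eq degree_power_eq del: power_Suc)
    also have "\<dots> < ?m + ?m * degree r" by simp
    also have "\<dots> = ?m * Suc (degree r)" by simp
    also have "\<dots> \<le> ?m * degree b" using less by (intro mult_le_mono) auto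
    also have "\<dots> \<le> degree (z * b ^ ?m)"
      using b \<open>z \<noteq> 0\<close> by (simp add: degree_mult_eq degree_power_eq del: power_Suc)
    finally show False unfolding eq by simp
  qed
  then show ?thesis using \<open>x = y + _\<close> by (simp add: y_def)
qed

text \<open>
All powers of an integral \<open>x = a/b\<close> are combinations of \<open>1, ..., x^(n-1)\<close>, so they share the
denominator \<open>b^n\<close>.
\<close>

lemma integral_over_poly:
  fixes x :: "'k::field poly fract"
  assumes p: "lead_coeff p = 1" "\<And>i. coeff p i \<in> range to_fract" "poly p x = 0"
  shows "x \<in> range to_fract"
proof -
  obtain a b where x: "x = to_fract a / to_fract b" and b: "b \<noteq> 0"
    by (cases x) (auto simp: Fract_conv_to_fract)
  let ?n = "degree p"
  have "to_fract (b ^ ?n) * x ^ m \<in> range to_fract" for m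
  proof (induction m rule: less_induct)
    case (less m)
    show ?case
    proof (cases "m < ?n")
      case True
      then have "b ^ ?n = b ^ (?n - m) * b ^ m" by (simp add: power_add[symmetric])
      then have "to_fract (b ^ ?n) * x ^ m = to_fract (b ^ (?n - m) * a ^ m)"
        using b by (simp add: x to_fract_power power_divide)
      then show ?thesis by (metis rangeI)
    next
      case False
      have "0 = (\<Sum>i<?n. coeff p i * x ^ i) + x ^ ?n"
        using p(1,3) by (simp add: poly_altdef lessThan_Suc_atMost[symmetric])
      then have "x ^ ?n = (\<Sum>i<?n. - coeff p i * x ^ i)"
        by (simp add: sum_negf eq_neg_iff_add_eq_0 add.commute)
      then have "x ^ ?n * x ^ (m - ?n) = (\<Sum>i<?n. - coeff p i * x ^ i) * x ^ (m - ?n)"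
        by simp
      then have "x ^ m = (\<Sum>i<?n. - coeff p i * x ^ (i + (m - ?n)))"
        using False by (simp add: sum_distrib_right power_add[symmetric] mult.assoc)
      then have "to_fract (b ^ ?n) * x ^ m =
          (\<Sum>i<?n. - coeff p i * (to_fract (b ^ ?n) * x ^ (i + (m - ?n))))"
        by (simp add: sum_distrib_left mult_ac sum_negf)
      also have "\<dots> \<in> range to_fract"
      proof (rule sum_mem)
        show "(0::'k poly fract) \<in> range to_fract" by (metis rangeI to_fract_0)
        show "u + v \<in> range to_fract" if "u \<in> range to_fract" "v \<in> range to_fract" for u v :: "'k poly fract"
          using that by (auto simp flip: to_fract_add)
        fix i assume "i \<in> {..<?n}"
        then have "to_fract (b ^ ?n) * x ^ (i + (m - ?n)) \<in> range to_fract"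
          using False by (intro less) auto
        with p(2)[of i] show "- coeff p i * (to_fract (b ^ ?n) * x ^ (i + (m - ?n))) \<in> range to_fract"
          by (metis (no_types, lifting) imageE rangeI to_fract_mult to_fract_uminus)
      qed
      finally show ?thesis .
    qed
  qed
  then show ?thesis by (rule almost_integral_over_poly[rotated]) (use b in simp)
qed


section \<open>Numerical semigroups and the conductor ideal\<close>

locale numerical_semigroup =
  fixes H :: "nat set" and e c :: nat
  assumes zero_mem: "0 \<in> H"
    and add_mem: "\<And>a b. a \<in> H \<Longrightarrow> b \<in> H \<Longrightarrow> a + b \<in> H"
    and multiplicity_mem: "e \<in> H" and multiplicity_pos: "0 < e"
    and multiplicity_le: "\<And>h. h \<in> H \<Longrightarrow> h \<noteq> 0 \<Longrightarrow> e \<le> h"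
    and conductor_mem: "\<And>m. c \<le> m \<Longrightarrow> m \<in> H"
    and conductor_least: "0 < c \<Longrightarrow> c - 1 \<notin> H"
begin

text \<open>
The exponents of the entries of a presentation matrix of the conductor: \<open>e\<close> is the number of its generators,
whose degrees are consecutive, so a binomial syzygy has two exponents in \<open>H\<close> at distance less than \<open>e\<close>.
\<close>

definition crowded :: "nat set" where
  "crowded = {h \<in> H. \<exists>h'\<in>H. h' \<noteq> h \<and> h < h' + e \<and> h' < h + e}"

lemma crowdedI: "h \<in> H \<Longrightarrow> h' \<in> H \<Longrightarrow> h' \<noteq> h \<Longrightarrow> h < h' + e \<Longrightarrow> h' < h + e \<Longrightarrow> h \<in> crowded"
  by (auto simp: crowded_def)

lemma add_submonoid: "add_submonoid H"
  using zero_mem add_mem by (simp add: add_submonoid_def)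

lemma multiple_mem: "e dvd m \<Longrightarrow> m \<in> H"
  using submonoid_mult[OF add_submonoid multiplicity_mem] by (auto simp: mult.commute elim!: dvdE)

text \<open>
An exponent \<open>m < c\<close> could be shifted by a power of \<open>t\<close> to \<open>c - 1\<close>, which is a gap of \<open>H\<close>.
\<close>

lemma mem_conductorI:
  assumes "\<And>m. t_fract ^ m * y \<in> monomial_span H"
  shows "y \<in> monomial_span {c..}"
proof -
  from assms[of 0] obtain p where p: "y = to_fract p" by (auto elim: monomial_spanE)
  have "c \<le> m" if "coeff p m \<noteq> 0" for m
  proof (rule ccontr)
    assume "\<not> c \<le> m"
    then have less: "m < c" by simp
    have "to_fract (monom 1 (c - 1 - m) * p) \<in> monomial_span H"
      using assms[of "c - 1 - m"] unfolding p t_fract_power to_fract_mult .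
    moreover have "coeff (monom 1 (c - 1 - m) * p) (c - 1) \<noteq> 0"
      using less that by (simp add: coeff_monom_mult)
    ultimately have "c - 1 \<in> H" unfolding to_fract_mem_monomial_span by blast
    with conductor_least less show False by simp
  qed
  then show ?thesis unfolding p to_fract_mem_monomial_span by simp
qed

text \<open>
The monic equation is \<open>X^e = t^(m e)\<close>.
\<close>

lemma t_power_integral:
  "t_fract ^ m \<in> integral_closure (monomial_span H :: 'k::field poly fract set)"
proof -
  let ?y = "t_fract ^ m :: 'k poly fract"
  let ?p = "monom 1 e - [:t_fract ^ (m * e):] :: 'k poly fract poly"
  have "?y = t_fract ^ (c + m) / t_fract ^ c" by (simp add: power_add)
  then have "?y \<in> total_quotient_ring (monomial_span H)"
    unfolding total_quotient_ring_def using conductor_mem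
    by (smt (verit) le_add1 mem_Collect_eq order_refl power_not_zero t_fract_nonzero t_power_mem_monomial_span)
  moreover have "lead_coeff ?p = 1"
  proof -
    have "degree ?p = e"
      using multiplicity_pos by (subst diff_conv_add_uminus, subst degree_add_eq_left) (auto simp: degree_monom_eq)
    then show ?thesis using multiplicity_pos by (simp add: coeff_eq_0)
  qed
  moreover have "coeff ?p i \<in> monomial_span H" for i
  proof -
    have "- (t_fract ^ (m * e)) \<in> (monomial_span H :: 'k poly fract set)"
      using monomial_mem_monomial_span[of "-1" "m * e" H] multiple_mem[of "m * e"] by simp
    moreover have "1 \<in> (monomial_span H :: 'k poly fract set)"
      using zero_mem by (rule one_mem_monomial_span)
    ultimately show ?thesis
      using multiplicity_pos by (cases i) (auto simp: coeff_eq_0)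
  qed
  moreover have "poly ?p ?y = 0" by (simp add: poly_monom power_mult)
  ultimately show ?thesis unfolding integral_closure_def by blast
qed

text \<open>
It suffices to know that the integral closure contains the powers of \<open>t\<close> and consists of polynomials.
\<close>

lemma conductor_monomial_span:
  "conductor (monomial_span H) = (monomial_span {c..} :: 'k::field poly fract set)"
proof (intro subset_antisym subsetI)
  fix x :: "'k poly fract" assume "x \<in> conductor (monomial_span H)"
  then have "x * y \<in> monomial_span H" if "y \<in> integral_closure (monomial_span H)" for y
    using that by (simp add: conductor_def)
  then have "t_fract ^ m * x \<in> monomial_span H" for m
    unfolding mult.commute[of _ x] using t_power_integral by blast
  then show "x \<in> monomial_span {c..}" by (rule mem_conductorI)
next
  fix x :: "'k poly fract" assume x: "x \<in> monomial_span {c..}"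
  have sub: "monomial_span {c..} \<subseteq> (monomial_span H :: 'k poly fract set)"
    using conductor_mem by (auto simp: monomial_span_def)
  have "1 \<in> (monomial_span H :: 'k poly fract set)"
    using zero_mem by (rule one_mem_monomial_span)
  then have "x \<in> total_quotient_ring (monomial_span H)"
    unfolding total_quotient_ring_def using x sub
    by (smt (verit) div_by_1 mem_Collect_eq one_neq_zero subsetD)
  moreover have "x * y \<in> monomial_span H" if "y \<in> integral_closure (monomial_span H)" for y
  proof -
    from that obtain p where "lead_coeff p = 1" "\<And>i. coeff p i \<in> range to_fract" "poly p y = 0"
      using monomial_span_subset_polys[of H] unfolding integral_closure_def by blast
    then have "y \<in> range to_fract" by (rule integral_over_poly)
    then have "y \<in> monomial_span UNIV" by (auto simp: monomial_span_def)
    then have "x * y \<in> monomial_span {c..}"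
      by (rule mult_mem_monomial_span[OF x]) simp
    with sub show ?thesis by blast
  qed
  ultimately show "x \<in> conductor (monomial_span H)" by (simp add: conductor_def)
qed

end

section \<open>Minimal generators of the conductor ideal\<close>

lemma scalar_prod_homogeneous:
  fixes g x :: "'k::field poly fract vec"
  assumes "\<And>i. i < p \<Longrightarrow> g $ i = const_fract (\<gamma> i) * t_fract ^ n i"
    and "\<And>i. i < p \<Longrightarrow> x $ i = to_fract (X i)" and "dim_vec x = p"
  shows "g \<bullet> x = to_fract (\<Sum>i<p. monom (\<gamma> i) (n i) * X i)"
  using assms by (simp add: scalar_prod_def to_fract_monom lessThan_atLeast0)

lemma free_module_polys:
  fixes x :: "'k::field poly fract vec"
  assumes "x \<in> free_module (monomial_span H) p"
  obtains X where "\<And>i. i < p \<Longrightarrow> x $ i = to_fract (X i)"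
    and "\<And>i m. i < p \<Longrightarrow> coeff (X i) m \<noteq> 0 \<Longrightarrow> m \<in> H"
proof -
  have "\<exists>P. x $ i = to_fract P \<and> (\<forall>m. coeff P m \<noteq> 0 \<longrightarrow> m \<in> H)" if "i < p" for i
    using assms that by (auto simp: free_module_def elim!: monomial_spanE)
  then show ?thesis using that by metis
qed

text \<open>
A generator expressible by the others can be eliminated from every linear combination, which
contradicts minimality.
\<close>

lemma redundant_generator:
  fixes g y :: "'k::field poly fract vec"
  assumes H: "add_submonoid H"
    and min: "min_homogeneous_gens (monomial_span H) M g d"
    and i: "i < dim_vec g" and y: "y \<in> free_module (monomial_span H) (dim_vec g)" "y $ i = 0"
  shows "g $ i \<noteq> g \<bullet> y"
proof
  assume eq: "g $ i = g \<bullet> y"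
  let ?p = "dim_vec g"
  define R :: "'k poly fract set" where "R = monomial_span H"
  have R: "\<And>a b. a \<in> R \<Longrightarrow> b \<in> R \<Longrightarrow> a + b \<in> R" "\<And>a b. a \<in> R \<Longrightarrow> b \<in> R \<Longrightarrow> a * b \<in> R" "0 \<in> R"
    using H by (auto simp: R_def add_submonoid_def intro: add_mem_monomial_span mult_mem_monomial_span)
  note min = min[folded R_def] and y = y[folded R_def]
  have "\<exists>x'\<in>free_module R ?p. x' $ i = 0 \<and> g \<bullet> x' = g \<bullet> x" if x: "x \<in> free_module R ?p" for x
  proof -
    (* Subtract x $ i times the relation that expresses g $ i by the other generators. *)
    define x' where "x' = vec ?p (\<lambda>l. x $ l + x $ i * (y $ l - (if l = i then 1 else 0)))"
    have "x' $ i = 0" using i y(2) by (simp add: x'_def)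
    moreover have "x' $ l \<in> R" if "l < ?p" for l
      using x y i that R by (cases "l = i") (auto simp: x'_def free_module_def)
    then have "x' \<in> free_module R ?p" by (simp add: free_module_def x'_def)
    moreover have "g \<bullet> x' = g \<bullet> x"
    proof -
      have "g \<bullet> x' = (\<Sum>l<?p. g $ l * x $ l + x $ i * (g $ l * y $ l) - x $ i * (if l = i then g $ l else 0))"
        by (simp add: scalar_prod_def x'_def lessThan_atLeast0 algebra_simps)
          (intro sum.cong, auto simp: algebra_simps)
      also have "\<dots> = (\<Sum>l<?p. g $ l * x $ l) + x $ i * (\<Sum>l<?p. g $ l * y $ l) - x $ i * g $ i"
        using i by (simp add: sum.distrib sum_subtractf sum_distrib_left[symmetric])
      also have "\<dots> = g \<bullet> x + x $ i * (g \<bullet> y) - x $ i * g $ i"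
        using x y by (auto simp: scalar_prod_def free_module_def lessThan_atLeast0)
      finally show ?thesis using eq by simp
    qed
    ultimately show ?thesis by blast
  qed
  then have "M = {g \<bullet> x | x. x \<in> free_module R ?p \<and> x $ i = 0}"
    using min unfolding min_homogeneous_gens_def by (smt (verit) Collect_cong)
  with min i show False unfolding min_homogeneous_gens_def by blast
qed

text \<open>
Minimal homogeneous generators of \<open>t^c k[t]\<close>, normalised: monomials with unit coefficients whose degrees
run once through \<open>c, ..., c + e - 1\<close>.
\<close>

locale conductor_generators = numerical_semigroup H e c
  for H :: "nat set" and e c :: nat +
  fixes g :: "'k::field poly fract vec" and \<gamma> :: "nat \<Rightarrow> 'k" and n :: "nat \<Rightarrow> nat"
  assumes coeff_nonzero: "\<And>i. i < dim_vec g \<Longrightarrow> \<gamma> i \<noteq> 0"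
    and generator_eq: "\<And>i. i < dim_vec g \<Longrightarrow> g $ i = const_fract (\<gamma> i) * t_fract ^ n i"
    and degrees: "bij_betw n {..<dim_vec g} {c..<c + e}"

text \<open>
Two degrees never differ by an element of \<open>H\<close>, since the larger generator would be redundant; this makes
the degrees distinct and, together with the next fact, smaller than \<open>c + e\<close>.  Each of the first \<open>e\<close> degrees does occur, because
a monomial \<open>t^l\<close> with \<open>l < c + e\<close> is a combination of generators of degree at least \<open>c\<close>, and \<open>H\<close>
has no positive element below \<open>e\<close>.
\<close>

lemma (in numerical_semigroup) conductor_generatorsE:
  fixes g :: "'k::field poly fract vec"
  assumes min: "min_homogeneous_gens (monomial_span H) (monomial_span {c..}) g d"
  obtains \<gamma> n where "conductor_generators H e c g \<gamma> n"
proof -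
  let ?p = "dim_vec g" and ?R = "monomial_span H :: 'k poly fract set"
  note redundant = redundant_generator[OF add_submonoid min]
  have one: "1 \<in> ?R" using zero_mem by (rule one_mem_monomial_span)
  have span: "monomial_span {c..} = {g \<bullet> x | x. x \<in> free_module ?R ?p}"
    using min by (simp add: min_homogeneous_gens_def)
  have "\<forall>i<?p. \<exists>a. g $ i = const_fract a * t_fract powi d i"
    using min by (simp add: min_homogeneous_gens_def homogeneous_def)
  then obtain \<gamma> where \<gamma>: "\<And>i. i < ?p \<Longrightarrow> g $ i = const_fract (\<gamma> i) * t_fract powi d i"
    by metis
  have \<gamma>_nz: "\<gamma> i \<noteq> 0" if "i < ?p" for i
  proof
    assume "\<gamma> i = 0"
    then have "g $ i = g \<bullet> 0\<^sub>v ?p" using \<gamma>[OF that] by simp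
    moreover have "0\<^sub>v ?p \<in> free_module ?R ?p" by (simp add: free_module_def)
    ultimately show False using redundant[OF that, of "0\<^sub>v ?p"] that by simp
  qed
  have deg: "d i \<ge> 0 \<and> c \<le> nat (d i)" if i: "i < ?p" for i
  proof -
    have "unit_vec ?p i \<in> free_module ?R ?p"
      using i one by (auto simp: free_module_def unit_vec_def)
    moreover have "g \<bullet> unit_vec ?p i = g $ i"
      using i by (intro scalar_prod_right_unit)
    ultimately have "g $ i \<in> monomial_span {c..}"
      unfolding span by (intro CollectI exI[of _ "unit_vec ?p i"]) simp
    then show ?thesis
      using homogeneous_mem_monomial_span[of "\<gamma> i" "d i" "{c..}"] \<gamma>[OF i] \<gamma>_nz[OF i] by simp
  qed
  define n where "n i = nat (d i)" for i
  have g: "g $ i = const_fract (\<gamma> i) * t_fract ^ n i" if "i < ?p" for i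
    using \<gamma>[OF that] deg[OF that] by (simp add: n_def power_int_def)
  have incomparable: "n i - n j \<notin> H" if ij: "i < ?p" "j < ?p" "i \<noteq> j" "n j \<le> n i" for i j
  proof
    assume H: "n i - n j \<in> H"
    let ?r = "const_fract (\<gamma> i / \<gamma> j) * t_fract ^ (n i - n j) :: 'k poly fract"
    have "?r \<cdot>\<^sub>v unit_vec ?p j \<in> free_module ?R ?p"
      using H one ij monomial_mem_monomial_span[of "\<gamma> i / \<gamma> j" "n i - n j" H]
      by (auto simp: free_module_def unit_vec_def)
    moreover have "g \<bullet> (?r \<cdot>\<^sub>v unit_vec ?p j) = ?r * g $ j"
      using ij(2) by (subst scalar_prod_smult_right) (simp_all add: scalar_prod_right_unit[OF ij(2)])
    moreover have "?r * g $ j = g $ i"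
    proof -
      have "?r * g $ j = const_fract (\<gamma> i / \<gamma> j * \<gamma> j) * (t_fract ^ (n i - n j) * t_fract ^ n j)"
        unfolding g[OF ij(2)] const_fract_simps by (simp only: mult_ac)
      then show ?thesis using g[OF ij(1)] \<gamma>_nz[OF ij(2)] ij(4)
        by (simp add: power_add[symmetric] del: const_fract_simps(4))
    qed
    ultimately show False
      using redundant[OF ij(1), of "?r \<cdot>\<^sub>v unit_vec ?p j"] ij by simp
  qed
  have surj: "\<exists>i<?p. n i = l" if l: "l \<in> {c..<c + e}" for l
  proof -
    have "t_fract ^ l \<in> (monomial_span {c..} :: 'k poly fract set)" using l by simp
    then obtain x where x: "x \<in> free_module ?R ?p" and tx: "t_fract ^ l = g \<bullet> x"
      unfolding span by blast
    obtain X where X: "\<And>i. i < ?p \<Longrightarrow> x $ i = to_fract (X i)"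
        "\<And>i m. i < ?p \<Longrightarrow> coeff (X i) m \<noteq> 0 \<Longrightarrow> m \<in> H"
      using free_module_polys[OF x] by blast
    have "to_fract (monom 1 l) = to_fract (\<Sum>i<?p. monom (\<gamma> i) (n i) * X i)"
      using tx scalar_prod_homogeneous[of ?p g \<gamma> n x X, OF g X(1)] x
      by (simp add: free_module_def t_fract_power del: to_fract_sum)
    then have "coeff (\<Sum>i<?p. monom (\<gamma> i) (n i) * X i) l = 1"
      unfolding to_fract_eq_iff by (metis coeff_monom)
    then obtain i where i: "i < ?p" "coeff (monom (\<gamma> i) (n i) * X i) l \<noteq> 0"
      unfolding coeff_sum by (metis (no_types, lifting) lessThan_iff sum.neutral zero_neq_one)
    then have "n i \<le> l" "l - n i \<in> H"
      using X(2)[OF i(1)] by (auto simp: coeff_monom_mult split: if_splits)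
    moreover have "l - n i < e" using l deg[OF i(1)] by (auto simp: n_def)
    ultimately have "l = n i" using multiplicity_le[of "l - n i"] by auto
    with i(1) show ?thesis by blast
  qed
  have bound: "n i < c + e" if i: "i < ?p" for i
  proof (rule ccontr)
    assume large: "\<not> n i < c + e"
    (* The generator in the residue class of n i would make g $ i redundant. *)
    obtain j where j: "j < ?p" "n j = c + (n i - c) mod e"
      using surj[of "c + (n i - c) mod e"] multiplicity_pos by auto
    have "n i - n j = (n i - c) div e * e"
      using j(2) large by (simp add: minus_mod_eq_div_mult[symmetric])
    then have "n i - n j \<in> H" by (simp add: multiple_mem)
    moreover have "n j < c + e" using j(2) multiplicity_pos by simp
    ultimately show False using incomparable[OF i j(1)] large by fastforce
  qed
  have "inj_on n {..<?p}"
  proof (rule inj_onI, rule ccontr)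
    fix i j assume "i \<in> {..<?p}" "j \<in> {..<?p}" "n i = n j" "i \<noteq> j"
    then show False using incomparable[of i j] zero_mem by simp
  qed
  moreover have "n ` {..<?p} = {c..<c + e}"
    using surj bound deg by (auto simp: n_def) (metis imageI lessThan_iff atLeastLessThan_iff image_iff)+
  ultimately have "bij_betw n {..<?p} {c..<c + e}" by (simp add: bij_betw_def)
  with \<gamma>_nz g have "conductor_generators H e c g \<gamma> n" by unfold_locales
  then show ?thesis by (rule that)
qed

section \<open>Exponents of syzygies\<close>

context conductor_generators
begin

abbreviation R :: "'k poly fract set" where "R \<equiv> monomial_span H"

abbreviation \<Omega> :: "'k poly fract vec set" where "\<Omega> \<equiv> syzygies R g"

abbreviation p :: nat where "p \<equiv> dim_vec g"

lemma degree_bounds: "i < p \<Longrightarrow> c \<le> n i \<and> n i < c + e"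
  using bij_betw_apply[OF degrees, of i] by simp

lemma degree_inj: "i < p \<Longrightarrow> j < p \<Longrightarrow> n i = n j \<longleftrightarrow> i = j"
  using inj_on_eq_iff[OF bij_betw_imp_inj_on[OF degrees], of i j] by simp

lemma degree_attained:
  assumes "c \<le> l" "l < c + e"
  obtains i where "i < p" "n i = l"
proof -
  have "l \<in> n ` {..<p}" using assms bij_betw_imp_surj_on[OF degrees] by simp
  then show ?thesis by (auto intro: that)
qed

lemma one_mem: "1 \<in> R"
  using zero_mem by (rule one_mem_monomial_span)

lemma syzygy_component: "x \<in> \<Omega> \<Longrightarrow> i < p \<Longrightarrow> x $ i \<in> R"
  by (simp add: syzygies_def free_module_def)

lemma syzygy_dim: "x \<in> \<Omega> \<Longrightarrow> dim_vec x = p"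
  by (auto simp: syzygies_def free_module_def)

lemma syzygyI:
  assumes "dim_vec x = p" "\<And>i. i < p \<Longrightarrow> x $ i \<in> R" "(\<Sum>i<p. g $ i * x $ i) = 0"
  shows "x \<in> \<Omega>"
proof -
  have "g \<bullet> x = 0" using assms(3) unfolding scalar_prod_def assms(1) lessThan_atLeast0 .
  moreover have "x \<in> free_module R p" 
    unfolding free_module_def using carrier_vecI[OF assms(1)] assms(2) by blast
  ultimately show ?thesis by (simp add: syzygies_def)
qed

lemma syzygy_sum: "x \<in> \<Omega> \<Longrightarrow> (\<Sum>i<p. g $ i * x $ i) = 0"
proof -
  assume x: "x \<in> \<Omega>"
  then have "g \<bullet> x = 0" by (simp add: syzygies_def)
  then show ?thesis unfolding scalar_prod_def syzygy_dim[OF x] lessThan_atLeast0 .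
qed

lemma syzygy_add:
  assumes "x \<in> \<Omega>" "y \<in> \<Omega>" shows "x + y \<in> \<Omega>"
  using assms syzygy_sum[of x] syzygy_sum[of y]
  by (intro syzygyI)
    (auto simp: syzygy_dim syzygy_component distrib_left sum.distrib intro: add_mem_monomial_span)

lemma syzygy_smult:
  assumes "r \<in> R" "x \<in> \<Omega>" shows "r \<cdot>\<^sub>v x \<in> \<Omega>"
proof (rule syzygyI)
  show "dim_vec (r \<cdot>\<^sub>v x) = p" using assms(2) by (simp add: syzygy_dim)
  show "(r \<cdot>\<^sub>v x) $ i \<in> R" if "i < p" for i
    using that assms syzygy_component[OF assms(2) that] mult_mem_monomial_span[of r H "x $ i" H H] add_mem
    by (simp add: syzygy_dim)
  have "(\<Sum>i<p. g $ i * (r \<cdot>\<^sub>v x) $ i) = r * (\<Sum>i<p. g $ i * x $ i)"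
    unfolding sum_distrib_left using assms(2) by (intro sum.cong) (auto simp: syzygy_dim)
  then show "(\<Sum>i<p. g $ i * (r \<cdot>\<^sub>v x) $ i) = 0" using syzygy_sum[OF assms(2)] by simp
qed

text \<open>
The term \<open>t^h\<close> of the component \<open>i\<close> contributes to the relation in degree \<open>h + n i\<close>, so another
component must contribute in the same degree.
\<close>

lemma syzygy_cancellation:
  assumes x: "x \<in> \<Omega>" and i: "i < p" and X: "x $ i = to_fract X" and h: "coeff X h \<noteq> 0"
  obtains j where "j < p" "j \<noteq> i" "n j \<le> h + n i" "h + n i - n j \<in> H"
proof -
  obtain Y where Y: "\<And>l. l < p \<Longrightarrow> x $ l = to_fract (Y l)"
      "\<And>l m. l < p \<Longrightarrow> coeff (Y l) m \<noteq> 0 \<Longrightarrow> m \<in> H"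
    using free_module_polys[of x H p] x by (auto simp: syzygies_def)
  let ?F = "\<lambda>l. coeff (monom (\<gamma> l) (n l) * Y l) (h + n i)"
  have "to_fract (\<Sum>l<p. monom (\<gamma> l) (n l) * Y l) = to_fract 0"
    using scalar_prod_homogeneous[of p g \<gamma> n x Y, OF generator_eq Y(1) syzygy_dim[OF x]] x
    by (simp add: syzygies_def del: to_fract_sum)
  then have "(\<Sum>l<p. ?F l) = 0"
    unfolding to_fract_eq_iff coeff_sum[symmetric] by simp
  moreover have "?F i \<noteq> 0"
    using h X Y(1)[OF i] coeff_nonzero[OF i] by (simp add: coeff_monom_mult)
  moreover have "(\<Sum>l<p. ?F l) = ?F i + (\<Sum>l\<in>{..<p} - {i}. ?F l)"
    using i by (intro sum.remove) auto
  ultimately have "(\<Sum>l\<in>{..<p} - {i}. ?F l) \<noteq> 0" by auto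
  then obtain j where j: "j \<in> {..<p} - {i}" "?F j \<noteq> 0" by (meson sum.neutral)
  then have "n j \<le> h + n i" "h + n i - n j \<in> H"
    using Y(2)[of j] by (auto simp: coeff_monom_mult split: if_splits)
  with j(1) show ?thesis by (intro that) auto
qed

lemma syzygy_component_crowded:
  assumes x: "x \<in> \<Omega>" and i: "i < p"
  shows "x $ i \<in> monomial_span crowded"
proof -
  obtain X where X: "x $ i = to_fract X" "\<And>m. coeff X m \<noteq> 0 \<Longrightarrow> m \<in> H"
    using syzygy_component[OF x i] by (metis monomial_spanE)
  have "h \<in> crowded" if h: "coeff X h \<noteq> 0" for h
  proof -
    obtain j where j: "j < p" "j \<noteq> i" "n j \<le> h + n i" "h + n i - n j \<in> H"
      using syzygy_cancellation[OF x i X(1) h] .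
    then show ?thesis
      using X(2)[OF h] degree_bounds[OF i] degree_bounds[OF j(1)] degree_inj[OF j(1) i]
      by (intro crowdedI[of h "h + n i - n j"]) auto
  qed
  then show ?thesis unfolding X(1) to_fract_mem_monomial_span by blast
qed

text \<open>
The relation between the generators \<open>i\<close> and \<open>j\<close> in degree \<open>a + n i = b + n j\<close>, normalised to have
the component \<open>t^a\<close> at \<open>i\<close>.
\<close>

definition binomial_syzygy :: "nat \<Rightarrow> nat \<Rightarrow> nat \<Rightarrow> nat \<Rightarrow> 'k poly fract vec" where
  "binomial_syzygy i j a b = vec p (\<lambda>l. if l = i then t_fract ^ a
     else if l = j then - (const_fract (\<gamma> i / \<gamma> j) * t_fract ^ b) else 0)"

lemma binomial_syzygy:
  assumes ij: "i < p" "j < p" "i \<noteq> j" and ab: "a \<in> H" "b \<in> H" "a + n i = b + n j"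
  shows "binomial_syzygy i j a b \<in> \<Omega>"
proof (rule syzygyI)
  let ?y = "- (const_fract (\<gamma> i / \<gamma> j) * t_fract ^ b) :: 'k poly fract"
  show "dim_vec (binomial_syzygy i j a b) = p" by (simp add: binomial_syzygy_def)
  have "?y \<in> R"
    using monomial_mem_monomial_span[of "- (\<gamma> i / \<gamma> j)" b H] ab(2)
    unfolding const_fract_simps by simp
  then show "binomial_syzygy i j a b $ l \<in> R" if "l < p" for l
    using that ab(1) by (auto simp: binomial_syzygy_def)
  have "g $ j * ?y = - (const_fract (\<gamma> i / \<gamma> j * \<gamma> j) * (t_fract ^ b * t_fract ^ n j))"
    unfolding generator_eq[OF ij(2)] const_fract_simps by (simp only: mult_ac mult_minus_left mult_minus_right)
  also have "\<dots> = - (const_fract (\<gamma> i) * (t_fract ^ a * t_fract ^ n i))"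
    using coeff_nonzero[OF ij(2)] ab(3) unfolding power_add[symmetric]
    by (simp del: const_fract_simps(4))
  also have "\<dots> = - (g $ i * t_fract ^ a)"
    unfolding generator_eq[OF ij(1)] by (simp only: mult_ac)
  finally have cancel: "g $ i * t_fract ^ a + g $ j * ?y = 0" by simp
  have "(\<Sum>l<p. g $ l * binomial_syzygy i j a b $ l) =
      (\<Sum>l<p. (if l = i then g $ i * t_fract ^ a else 0) + (if l = j then g $ j * ?y else 0))"
    using ij(3) by (intro sum.cong) (auto simp: binomial_syzygy_def)
  also have "\<dots> = g $ i * t_fract ^ a + g $ j * ?y"
    using ij by (simp add: sum.distrib)
  finally show "(\<Sum>l<p. g $ l * binomial_syzygy i j a b $ l) = 0"
    unfolding cancel .
qed

text \<open>
Since the generator degrees fill an interval of length \<open>e\<close>, every difference of absolute value less than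
\<open>e\<close> occurs between two of them.
\<close>

lemma crowded_power_component:
  assumes "h \<in> crowded"
  obtains x i where "x \<in> \<Omega>" "i < p" "x $ i = t_fract ^ h"
proof -
  obtain h' where h': "h \<in> H" "h' \<in> H" "h' \<noteq> h" "h < h' + e" "h' < h + e"
    using assms by (auto simp: crowded_def)
  obtain i where i: "i < p" "n i = c + (h' - h)"
  proof (rule degree_attained)
    show "c + (h' - h) < c + e" using h' multiplicity_pos by auto
  qed auto
  obtain j where j: "j < p" "n j = c + (h - h')"
  proof (rule degree_attained)
    show "c + (h - h') < c + e" using h' multiplicity_pos by auto
  qed auto
  have ij: "i \<noteq> j" "h + n i = h' + n j" using i(2) j(2) h'(3) by auto
  show ?thesis
  proof (rule that)
    show "binomial_syzygy i j h h' \<in> \<Omega>"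
      using i(1) j(1) ij h' by (intro binomial_syzygy) auto
    show "binomial_syzygy i j h h' $ i = t_fract ^ h" using i(1) by (simp add: binomial_syzygy_def)
  qed (fact i(1))
qed

lemma crowded_ideal: "\<forall>a\<in>H. \<forall>b\<in>crowded. a + b \<in> crowded"
proof (intro ballI)
  fix a b assume "a \<in> H" "b \<in> crowded"
  then obtain b' where "b \<in> H" "b' \<in> H" "b' \<noteq> b" "b < b' + e" "b' < b + e"
    by (auto simp: crowded_def)
  with \<open>a \<in> H\<close> show "a + b \<in> crowded"
    by (intro crowdedI[of _ "a + b'"]) (auto intro: add_mem)
qed

section \<open>Homomorphisms on the syzygy module\<close>

text \<open>
Fix the generator \<open>b\<close> of lowest degree \<open>c\<close>, and for each other index \<open>i\<close> the binomial syzygies \<open>v m i\<close> whose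
components at \<open>i\<close> and \<open>b\<close> have exponents \<open>c + m\<close> and \<open>n i + m\<close>; they exist for all \<open>m\<close> as both exponents are at least \<open>c\<close>.
Thus \<open>v m i\<close> acts as \<open>t^m\<close> times \<open>v 0 i\<close> although \<open>t^m\<close> need not lie in \<open>R\<close>.  All \<open>t^m * f (v 0 i)\<close>
are therefore in \<open>R\<close>, so \<open>f (v 0 i)\<close> is divisible by \<open>t^c\<close> in \<open>k[t]\<close>; the quotient is \<open>Q i\<close>.
The formula follows because \<open>t^c x\<close> is the combination of the \<open>v 0 i\<close> with coefficients \<open>x_i\<close>: at the
index \<open>b\<close> this is the syzygy relation of \<open>x\<close>.
\<close>

lemma homomorphism_extends:
  assumes f: "f \<in> dual_module R (\<cdot>\<^sub>v) \<Omega>"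
  obtains Q where "\<And>x. x \<in> \<Omega> \<Longrightarrow> f x = (\<Sum>i<p. x $ i * to_fract (Q i))"
proof -
  have f_mem: "f y \<in> R" if "y \<in> \<Omega>" for y
    using f that by (simp add: dual_module_def)
  have f_add: "f (y + z) = f y + f z" if "y \<in> \<Omega>" "z \<in> \<Omega>" for y z
    using f that by (simp add: dual_module_def)
  have f_smult: "f (r \<cdot>\<^sub>v y) = r * f y" if "r \<in> R" "y \<in> \<Omega>" for r y
    using f that by (simp add: dual_module_def)
  obtain b where b: "b < p" "n b = c"
    using degree_attained[of c] multiplicity_pos by auto
  define v where "v m i = binomial_syzygy i b (c + m) (n i + m)" for m i
  let ?B = "{..<p} - {b}"
  have v: "v m i \<in> \<Omega>" if "i \<in> ?B" for m i
    using that b degree_bounds[of i] unfolding v_def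
    by (intro binomial_syzygy conductor_mem) auto
  have tR: "t_fract ^ (c + m) \<in> R" for m
    by (simp add: conductor_mem)
  have fv: "f (v 0 i) \<in> monomial_span {c..}" if i: "i \<in> ?B" for i
  proof (rule mem_conductorI)
    fix m
    have "t_fract ^ c \<cdot>\<^sub>v v m i = t_fract ^ (c + m) \<cdot>\<^sub>v v 0 i"
      by (rule eq_vecI) (auto simp: v_def binomial_syzygy_def power_add mult_ac)
    then have "t_fract ^ c * f (v m i) = t_fract ^ c * (t_fract ^ m * f (v 0 i))"
      using f_smult[OF tR[of 0] v[OF i, of m]] f_smult[OF tR[of m] v[OF i, of 0]]
      by (simp add: power_add mult.assoc)
    then have "f (v m i) = t_fract ^ m * f (v 0 i)" by simp
    then show "t_fract ^ m * f (v 0 i) \<in> R" using f_mem[OF v[OF i, of m]] by simp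
  qed
  have "\<exists>Q. f (v 0 i) = t_fract ^ c * to_fract Q" if i: "i \<in> ?B" for i
  proof -
    obtain P where P: "f (v 0 i) = to_fract P" "\<And>m. coeff P m \<noteq> 0 \<Longrightarrow> m \<in> {c..}"
      using fv[OF i] by (metis monomial_spanE)
    have "monom 1 c dvd P" using P(2) unfolding monom_1_dvd_iff' by force
    then obtain Q where "P = monom 1 c * Q" by (rule dvdE)
    then show ?thesis unfolding P(1) t_fract_power by auto
  qed
  then obtain Q where Q: "\<And>i. i \<in> ?B \<Longrightarrow> f (v 0 i) = t_fract ^ c * to_fract (Q i)"
    by metis
  (* The component b of a syzygy is determined by the others, so the value 0 is possible there. *)
  have "f x = (\<Sum>i<p. x $ i * to_fract ((Q(b := 0)) i))" if x: "x \<in> \<Omega>" for x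
  proof -
    (* Linearity of f for finite sums, by induction on the set B of summands. *)
    define w where "w B = vec p (\<lambda>l. \<Sum>i\<in>B. x $ i * v 0 i $ l)" for B
    have w: "w B \<in> \<Omega> \<and> f (w B) = (\<Sum>i\<in>B. x $ i * f (v 0 i))" if "finite B" "B \<subseteq> ?B" for B
      using that
    proof (induction B rule: finite_induct)
      case empty
      have w0: "w {} = 0\<^sub>v p" by (rule eq_vecI) (simp_all add: w_def)
      have "0\<^sub>v p \<in> \<Omega>" by (rule syzygyI) simp_all
      moreover from this have "f (0 \<cdot>\<^sub>v 0\<^sub>v p) = 0" by (subst f_smult) simp_all
      moreover have "0 \<cdot>\<^sub>v 0\<^sub>v p = (0\<^sub>v p :: 'k poly fract vec)" by (rule eq_vecI) simp_all
      ultimately show ?case unfolding w0 by simp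
    next
      case (insert i B)
      have vi: "v 0 i \<in> \<Omega>" using insert.prems by (intro v) auto
      have xi: "x $ i \<in> R" using insert.prems by (intro syzygy_component[OF x]) auto
      have IH: "w B \<in> \<Omega>" "f (w B) = (\<Sum>i\<in>B. x $ i * f (v 0 i))" using insert by auto
      have eq: "w (insert i B) = x $ i \<cdot>\<^sub>v v 0 i + w B"
        using insert.hyps syzygy_dim[OF vi] by (intro eq_vecI) (simp_all add: w_def)
      show ?case
        unfolding eq f_add[OF syzygy_smult[OF xi vi] IH(1)] f_smult[OF xi vi] IH(2)
        using syzygy_add[OF syzygy_smult[OF xi vi] IH(1)] insert.hyps by simp
    qed
    have "w ?B = t_fract ^ c \<cdot>\<^sub>v x"
    proof (rule eq_vecI)
      show "dim_vec (w ?B) = dim_vec (t_fract ^ c \<cdot>\<^sub>v x)" by (simp add: w_def syzygy_dim[OF x])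
      fix l assume "l < dim_vec (t_fract ^ c \<cdot>\<^sub>v x)"
      then have l: "l < p" by (simp add: syzygy_dim[OF x])
      have "(\<Sum>i\<in>?B. x $ i * v 0 i $ l) = t_fract ^ c * x $ l"
      proof (cases "l = b")
        case False
        then have "(\<Sum>i\<in>?B. x $ i * v 0 i $ l) = (\<Sum>i\<in>?B. if i = l then t_fract ^ c * x $ l else 0)"
          using l by (intro sum.cong) (auto simp: v_def binomial_syzygy_def)
        then show ?thesis using False l by simp
      next
        case True
        have g: "const_fract (\<gamma> b) * (x $ i * v 0 i $ b) = - (g $ i * x $ i)" if i: "i \<in> ?B" for i
        proof -
          have "v 0 i $ b = - (const_fract (\<gamma> i / \<gamma> b) * t_fract ^ n i)"
            using i b(1) by (auto simp: v_def binomial_syzygy_def)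
          then have "const_fract (\<gamma> b) * (x $ i * v 0 i $ b) =
              - (const_fract (\<gamma> b * (\<gamma> i / \<gamma> b)) * t_fract ^ n i * x $ i)"
            unfolding const_fract_simps by (simp only: mult_ac mult_minus_left mult_minus_right)
          then show ?thesis
            using coeff_nonzero[OF b(1)] generator_eq[of i] i by (simp del: const_fract_simps(4))
        qed
        have "0 = g $ b * x $ b + (\<Sum>i\<in>?B. g $ i * x $ i)"
          using sum.remove[of "{..<p}" b "\<lambda>i. g $ i * x $ i"] b(1) syzygy_sum[OF x] by simp
        then have "g $ b * x $ b = (\<Sum>i\<in>?B. - (g $ i * x $ i))"
          by (simp add: sum_negf eq_neg_iff_add_eq_0)
        also have "\<dots> = const_fract (\<gamma> b) * (\<Sum>i\<in>?B. x $ i * v 0 i $ b)"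
          unfolding sum_distrib_left using g by (intro sum.cong) auto
        finally have "const_fract (\<gamma> b) * (t_fract ^ c * x $ b) = const_fract (\<gamma> b) * (\<Sum>i\<in>?B. x $ i * v 0 i $ b)"
          unfolding generator_eq[OF b(1)] b(2) by (simp only: mult.assoc)
        then show ?thesis using coeff_nonzero[OF b(1)] True by simp
      qed
      then show "w ?B $ l = (t_fract ^ c \<cdot>\<^sub>v x) $ l"
        using l by (simp add: w_def syzygy_dim[OF x])
    qed
    then have key: "t_fract ^ c * f x = (\<Sum>i\<in>?B. x $ i * f (v 0 i))"
      using w[of ?B] f_smult[OF tR[of 0] x] by simp
    also have "\<dots> = t_fract ^ c * (\<Sum>i\<in>?B. x $ i * to_fract (Q i))"
      unfolding sum_distrib_left by (intro sum.cong refl) (simp add: Q mult_ac)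
    also have "(\<Sum>i\<in>?B. x $ i * to_fract (Q i)) = (\<Sum>i<p. x $ i * to_fract ((Q(b := 0)) i))"
      using b(1) by (simp add: sum.remove[of "{..<p}" b])
    finally show ?thesis by simp
  qed
  then show ?thesis by (rule that)
qed

text \<open>
For an exponent \<open>h + q\<close> of the sum of the \<open>x_i Q_i\<close> a generator degree \<open>l\<close> is chosen such that
\<open>q + l - n i\<close> is a nonnegative multiple \<open>z\<close> of \<open>e\<close>.  Then \<open>h + z\<close> is the required neighbour in \<open>H\<close> unless \<open>l = n i\<close>;
in that case \<open>q = z\<close> is in \<open>H\<close>, and \<open>q\<close> is added to the exponent that cancels \<open>h\<close>.
\<close>

lemma homomorphism_value_crowded:
  assumes f: "f \<in> dual_module R (\<cdot>\<^sub>v) \<Omega>" and x: "x \<in> \<Omega>"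
  shows "f x \<in> monomial_span crowded"
proof -
  have fx: "f x \<in> R" using f x by (simp add: dual_module_def)
  obtain Q where Q: "f x = (\<Sum>i<p. x $ i * to_fract (Q i))"
    using homomorphism_extends[OF f] x by metis
  obtain F where F: "f x = to_fract F" "\<And>m. coeff F m \<noteq> 0 \<Longrightarrow> m \<in> H"
    using fx by (metis monomial_spanE)
  obtain X where X: "\<And>i. i < p \<Longrightarrow> x $ i = to_fract (X i)"
      "\<And>i m. i < p \<Longrightarrow> coeff (X i) m \<noteq> 0 \<Longrightarrow> m \<in> H"
    using free_module_polys[of x H p] x by (auto simp: syzygies_def)
  have "to_fract F = to_fract (\<Sum>i<p. X i * Q i)"
    using Q unfolding F(1) to_fract_mult to_fract_sum by (simp add: X(1))
  then have FXQ: "F = (\<Sum>i<p. X i * Q i)" unfolding to_fract_eq_iff .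
  have "m \<in> crowded" if m: "coeff F m \<noteq> 0" for m
  proof -
    have "(\<Sum>i<p. coeff (X i * Q i) m) \<noteq> 0"
      using m unfolding FXQ coeff_sum .
    then obtain i where i: "i \<in> {..<p}" "coeff (X i * Q i) m \<noteq> 0"
      by (meson sum.neutral)
    from i(2) obtain h where h: "h \<le> m" "coeff (X i) h * coeff (Q i) (m - h) \<noteq> 0"
      unfolding coeff_mult by (meson atMost_iff sum.neutral)
    have ip: "i < p" using i(1) by simp
    have hX: "coeff (X i) h \<noteq> 0" using h(2) by auto
    have hH: "h \<in> H" using X(2)[OF ip hX] .
    define q where "q = m - h"
    have m_eq: "m = h + q" using h(1) by (simp add: q_def)
    have mH: "m \<in> H" using F(2)[OF m] .
    (* u is the largest of the candidates q + l - n i; subtracting its residue selects a multiple of e. *)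
    define u where "u = q + (c + e - 1 - n i)"
    define l where "l = c + e - 1 - u mod e"
    have bounds: "c \<le> n i" "n i < c + e" using degree_bounds[OF ip] by auto
    have "u mod e < e" using multiplicity_pos by simp
    then have l: "c \<le> l" "l < c + e" unfolding l_def by linarith+
    have "q + l = n i + (u - u mod e)"
      using bounds \<open>u mod e < e\<close> mod_less_eq_dividend[of u e] u_def l_def by linarith
    moreover have "u - u mod e \<in> H" by (intro multiple_mem) (simp add: minus_mod_eq_mult_div)
    ultimately obtain z where z: "z \<in> H" "q + l = n i + z" by blast
    show ?thesis
    proof (cases "l = n i")
      case False
      have "h + z \<in> H" using hH z(1) by (rule add_mem)
      then show ?thesis
        using mH False z(2) l bounds unfolding m_eq by (intro crowdedI[of _ "h + z"]) auto
    next
      case True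
      then have qH: "q \<in> H" using z by simp
      obtain j where j: "j < p" "j \<noteq> i" "n j \<le> h + n i" "h + n i - n j \<in> H"
        using syzygy_cancellation[OF x ip X(1)[OF ip] hX] .
      have "q + (h + n i - n j) \<in> H" using qH j(4) by (rule add_mem)
      then show ?thesis
        using mH j(3) bounds degree_bounds[OF j(1)] degree_inj[OF j(1) ip] j(2) unfolding m_eq
        by (intro crowdedI[of _ "q + (h + n i - n j)"]) auto
    qed
  qed
  then show ?thesis unfolding F(1) to_fract_mem_monomial_span by blast
qed

text \<open>
The coordinate functions already take all crowded powers of \<open>t\<close> as values.
\<close>

lemma trace_syzygies: "trace_ideal R (\<cdot>\<^sub>v) \<Omega> = monomial_span crowded"
  unfolding trace_ideal_def
proof (rule ideal_generated_eq_monomial_span)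
  let ?X = "{f x |f x. f \<in> dual_module R (\<cdot>\<^sub>v) \<Omega> \<and> x \<in> \<Omega>}"
  show "?X \<subseteq> monomial_span crowded" using homomorphism_value_crowded by blast
  show "crowded \<subseteq> H" by (auto simp: crowded_def)
  fix I h assume I: "is_ideal R I" "?X \<subseteq> I" and "h \<in> crowded"
  then obtain x i where x: "x \<in> \<Omega>" "i < p" "x $ i = t_fract ^ h"
    using crowded_power_component by blast
  have "(\<lambda>x. x $ i) \<in> dual_module R (\<cdot>\<^sub>v) \<Omega>"
    unfolding dual_module_def using x(2) by (auto simp: syzygy_component syzygy_dim)
  then have "x $ i \<in> ?X"
    using x(1) by (intro CollectI exI[of _ "\<lambda>x. x $ i"] exI[of _ x]) simp
  with I(2) x(3) show "t_fract ^ h \<in> I" by auto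
qed (fact crowded_ideal zero_mem)+

lemma entry_ideal_presentation:
  assumes A: "dim_row A = p" "elements_mat A \<subseteq> R"
    and cols: "\<Omega> = {A *\<^sub>v y | y. y \<in> free_module R (dim_col A)}"
  shows "entry_ideal R A = monomial_span crowded"
  unfolding entry_ideal_def
proof (rule ideal_generated_eq_monomial_span)
  show "elements_mat A \<subseteq> monomial_span crowded"
  proof
    fix a assume "a \<in> elements_mat A"
    then obtain i j where ij: "i < dim_row A" "j < dim_col A" "a = A $$ (i, j)" by blast
    have "unit_vec (dim_col A) j \<in> free_module R (dim_col A)"
      using one_mem by (auto simp: free_module_def unit_vec_def)
    then have "A *\<^sub>v unit_vec (dim_col A) j \<in> \<Omega>" unfolding cols by blast
    then have "(A *\<^sub>v unit_vec (dim_col A) j) $ i \<in> monomial_span crowded"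
      using ij(1) A(1) by (intro syzygy_component_crowded) auto
    then show "a \<in> monomial_span crowded" using ij by simp
  qed
  show "crowded \<subseteq> H" by (auto simp: crowded_def)
  fix I h assume I: "is_ideal R I" "elements_mat A \<subseteq> I" and "h \<in> crowded"
  then obtain x i where x: "x \<in> \<Omega>" "i < p" "x $ i = t_fract ^ h"
    using crowded_power_component by blast
  then obtain y where y: "y \<in> free_module R (dim_col A)" "x = A *\<^sub>v y" unfolding cols by blast
  have "x $ i = (\<Sum>j<dim_col A. y $ j * A $$ (i, j))"
    using x(2) y A(1) by (auto simp: scalar_prod_def free_module_def lessThan_atLeast0 mult.commute)
  also have "\<dots> \<in> I"
  proof (rule sum_mem)
    show "0 \<in> I" "\<And>x y. x \<in> I \<Longrightarrow> y \<in> I \<Longrightarrow> x + y \<in> I" using I(1) by (simp_all add: is_ideal_def)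
    fix j assume "j \<in> {..<dim_col A}"
    then have "A $$ (i, j) \<in> I" "y $ j \<in> R"
      using I(2) x(2) A(1) y(1) by (auto simp: free_module_def)
    then show "y $ j * A $$ (i, j) \<in> I" using I(1) by (simp add: is_ideal_def)
  qed
  finally show "t_fract ^ h \<in> I" using x(3) by simp
qed (fact crowded_ideal zero_mem)+

end

section \<open>Semigroups whose crowded elements form the conductor\<close>

text \<open>
If no element of \<open>H\<close> below \<open>c\<close> is crowded, compare it, and \<open>c\<close> as well, with the multiple of \<open>e\<close> just below:
all of them must be multiples of \<open>e\<close>.  Conversely \<open>H\<close> then consists of multiples of \<open>e\<close> at
mutual distance at least \<open>e\<close>, followed by an interval starting at the multiple \<open>c\<close>.
\<close>

lemma (in numerical_semigroup) crowded_eq_conductor_iff: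
  "crowded = {c..} \<longleftrightarrow> e \<noteq> 1 \<and> (\<exists>s\<ge>1. H = {m. e dvd m \<or> s * e \<le> m})"
proof (intro iffI conjI)
  assume eq: "crowded = {c..}"
  show "e \<noteq> 1"
  proof
    assume "e = 1"
    then have "crowded = {}" unfolding crowded_def by auto
    with eq show False by auto
  qed
  have "0 \<notin> crowded" using multiplicity_le by (fastforce simp: crowded_def)
  then have "0 < c" using eq by auto
  have "e dvd c"
  proof (rule ccontr)
    assume "\<not> e dvd c"
    then have r: "0 < c mod e" "c mod e < e" "c mod e \<le> c"
      using multiplicity_pos by (auto simp: dvd_eq_mod_eq_0)
    have "c - c mod e \<in> H" by (intro multiple_mem) (simp add: minus_mod_eq_mult_div)
    moreover have "c \<in> H" by (rule conductor_mem) simp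
    moreover have "c \<noteq> c - c mod e" "c - c mod e < c + e" "c < c - c mod e + e"
      using r by linarith+
    ultimately have "c - c mod e \<in> crowded" by (rule crowdedI)
    then have "c \<le> c - c mod e" using eq by auto
    then show False using r by linarith
  qed
  then have "c = c div e * e" by simp
  then obtain s where s: "c = s * e" by blast
  with \<open>0 < c\<close> have "1 \<le> s" by (cases s) auto
  moreover have "H = {m. e dvd m \<or> s * e \<le> m}"
  proof (intro subset_antisym subsetI CollectI)
    fix m assume m: "m \<in> H"
    show "e dvd m \<or> s * e \<le> m"
    proof (rule disjCI, rule ccontr)
      assume "\<not> s * e \<le> m" "\<not> e dvd m"
      then have r: "m < c" "0 < m mod e" "m mod e < e" "m mod e \<le> m"
        using multiplicity_pos s by (auto simp: dvd_eq_mod_eq_0)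
      have "m - m mod e \<in> H" by (intro multiple_mem) (simp add: minus_mod_eq_mult_div)
      moreover have "m - m mod e \<noteq> m" "m < m - m mod e + e" "m - m mod e < m + e"
        using r by linarith+
      ultimately have "m \<in> crowded" by (rule crowdedI[OF m])
      then show False using eq r(1) by auto
    qed
  next
    fix m assume "m \<in> {m. e dvd m \<or> s * e \<le> m}"
    then show "m \<in> H" using multiple_mem conductor_mem s by auto
  qed
  ultimately show "\<exists>s\<ge>1. H = {m. e dvd m \<or> s * e \<le> m}" by blast
next
  assume "e \<noteq> 1 \<and> (\<exists>s\<ge>1. H = {m. e dvd m \<or> s * e \<le> m})"
  then obtain s where e: "2 \<le> e" and s: "1 \<le> s" and H: "H = {m. e dvd m \<or> s * e \<le> m}"
    using multiplicity_pos by auto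
  have se: "e \<le> s * e" using s by simp
  have c: "c = s * e"
  proof (rule antisym)
    show "c \<le> s * e"
    proof (rule ccontr)
      assume "\<not> c \<le> s * e"
      then have "0 < c" "s * e \<le> c - 1" by auto
      with conductor_least H show False by auto
    qed
    show "s * e \<le> c"
    proof (rule ccontr)
      assume "\<not> s * e \<le> c"
      then have "s * e - 1 \<in> H" by (intro conductor_mem) auto
      then have "e dvd s * e - 1" using H se e by auto
      then have "e dvd s * e - (s * e - 1)" by (rule dvd_diff_nat[OF dvd_triv_right])
      moreover have "s * e - (s * e - 1) = 1" using se e by linarith
      ultimately show False using e by simp
    qed
  qed
  show "crowded = {c..}"
  proof (intro subset_antisym subsetI)
    fix h assume "h \<in> crowded"
    then obtain h' where h: "h \<in> H" "h' \<in> H" "h' \<noteq> h" "h < h' + e" "h' < h + e"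
      by (auto simp: crowded_def)
    have "s * e \<le> h"
    proof (rule ccontr)
      assume less: "\<not> s * e \<le> h"
      then have "e dvd h" using h(1) H by auto
      then have "e dvd s * e - h" by (intro dvd_diff_nat) auto
      then have "e \<le> s * e - h" using less by (intro dvd_imp_le) auto
      then have "\<not> s * e \<le> h'" using h(5) less by linarith
      then have "e dvd h'" using h(2) H by auto
      then have "e dvd h' - h" "e dvd h - h'" using \<open>e dvd h\<close> by (auto intro: dvd_diff_nat)
      moreover have "0 < h' - h \<and> h' - h < e \<or> 0 < h - h' \<and> h - h' < e" using h by auto
      ultimately show False using nat_dvd_not_less by blast
    qed
    then show "h \<in> {c..}" using c by simp
  next
    fix h assume "h \<in> {c..}"
    then show "h \<in> crowded"
      using e by (intro crowdedI[of _ "Suc h"] conductor_mem) auto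
  qed
qed

section \<open>The semigroup of a list of generators\<close>

text \<open>
Bezout's identity with nonnegative coefficients; for greatest common divisor 1 it yields two consecutive elements,
from which all large numbers are combined.
\<close>

lemma submonoid_gcd_difference:
  fixes A :: "nat set"
  assumes M: "add_submonoid M" and "finite A" "A \<subseteq> M"
  shows "\<exists>v\<in>M. v + Gcd A \<in> M"
  using assms(2,3)
proof (induction A rule: finite_induct)
  case empty
  then show ?case using M by (auto simp: add_submonoid_def)
next
  case (insert a A)
  then obtain v where v: "v \<in> M" "v + Gcd A \<in> M" by auto
  show ?case
  proof (cases "a = 0")
    case True
    then show ?thesis using v by auto
  next
    case False
    then obtain x y where xy: "a * x = Gcd A * y + gcd a (Gcd A)"
      using bezout_nat by blast
    have "y * (v + Gcd A) \<in> M" using submonoid_mult[OF M v(2)] .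
    moreover have "y * (v + Gcd A) + Gcd (insert a A) = x * a + y * v"
      using xy by (simp add: algebra_simps)
    moreover have "x * a + y * v \<in> M"
      using M submonoid_mult[OF M, of a x] submonoid_mult[OF M v(1), of y] insert.prems
      by (auto simp: add_submonoid_def)
    ultimately show ?thesis by metis
  qed
qed

lemma submonoid_cofinite:
  assumes M: "add_submonoid M" and v: "v \<in> M" "v + 1 \<in> M" and m: "v * v \<le> m"
  shows "m \<in> M"
proof (cases "v = 0")
  case True
  then show ?thesis using submonoid_mult[OF M v(2), of m] by simp
next
  case False
  let ?q = "m div v" and ?r = "m mod v"
  have "v \<le> ?q" using m False by (simp add: less_eq_div_iff_mult_less_eq)
  then have le: "?r \<le> ?q" using mod_less_divisor[of v m] False by linarith
  (* As v is at most the quotient, the remainder can be spread as +1 over that many summands v. *)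
  have "m = ?q * v + ?r" by simp
  also have "\<dots> = (?q - ?r) * v + ?r * (v + 1)"
  proof -
    obtain k where "?q = ?r + k" using le le_Suc_ex by blast
    then show ?thesis by (simp add: algebra_simps)
  qed
  finally show ?thesis
    using M submonoid_mult[OF M v(1)] submonoid_mult[OF M v(2)]
    unfolding add_submonoid_def by metis
qed

lemma numerical_semigroup_of_gens:
  assumes gens: "numerical_semigroup_gens as"
  obtains c where "numerical_semigroup (add_submonoid hull set as) (as ! 0) c"
proof -
  let ?H = "add_submonoid hull set as"
  have M: "add_submonoid ?H" by (rule add_submonoid_hull)
  have gcd: "Gcd (set as) = 1" using gens by (simp add: numerical_semigroup_gens_def)
  then have "as \<noteq> []" by auto
  then have first: "as ! 0 \<in> set as" by simp
  have pos: "a > 0" if "a \<in> set as" for a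
  proof (rule ccontr)
    assume "\<not> a > 0"
    then have "a \<in> add_submonoid hull (set as - {a})"
      using add_submonoid_hull[of "set as - {a}"] by (simp add: add_submonoid_def)
    then show False using gens that by (simp add: numerical_semigroup_gens_def)
  qed
  have least: "as ! 0 \<le> a" if a: "a \<in> set as" for a
  proof -
    obtain k where k: "k < length as" "a = as ! k" using a by (auto simp: in_set_conv_nth)
    have "sorted_wrt (<) as" using gens unfolding numerical_semigroup_gens_def by blast
    then have "0 < k \<Longrightarrow> as ! 0 < as ! k" using k(1) by (simp add: sorted_wrt_iff_nth_less)
    then show ?thesis unfolding k(2) by (cases "k = 0") auto
  qed
  have "?H \<subseteq> {h. h = 0 \<or> as ! 0 \<le> h}"
    by (rule hull_minimal) (auto simp: add_submonoid_def intro: least)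
  then have least_H: "as ! 0 \<le> h" if "h \<in> ?H" "h \<noteq> 0" for h using that by blast
  obtain v where v: "v \<in> ?H" "v + 1 \<in> ?H"
    using submonoid_gcd_difference[OF M finite_set hull_subset] gcd by auto
  define c where "c = (LEAST c. \<forall>m\<ge>c. m \<in> ?H)"
  have ex: "\<forall>m\<ge>v * v. m \<in> ?H" using submonoid_cofinite[OF M v] by blast
  then have c: "\<forall>m\<ge>c. m \<in> ?H" unfolding c_def by (rule LeastI)
  have "c - 1 \<notin> ?H" if "0 < c"
  proof
    assume "c - 1 \<in> ?H"
    then have "\<forall>m\<ge>c - 1. m \<in> ?H" 
      using c by (metis Suc_diff_1 Suc_leI le_neq_implies_less that)
    then have "c \<le> c - 1" unfolding c_def by (rule Least_le)
    with that show False by simp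
  qed
  with M first pos least_H c have "numerical_semigroup ?H (as ! 0) c"
    by unfold_locales (auto simp: add_submonoid_def hull_inc)
  then show ?thesis by (rule that)
qed

section \<open>The rings in the second condition\<close>

lemma submonoid_hull_truncated_progression:
  assumes e: "0 < e" and s: "1 \<le> s"
  shows "add_submonoid hull (insert e {s * e + i | i. 1 \<le> i \<and> i \<le> e - 1}) = {m. e dvd m \<or> s * e \<le> m}"
proof (rule hull_unique)
  show "add_submonoid {m. e dvd m \<or> s * e \<le> m}" by (auto simp: add_submonoid_def)
next
  fix M assume G: "insert e {s * e + i | i. 1 \<le> i \<and> i \<le> e - 1} \<subseteq> M" and M: "add_submonoid M"
  have mult: "k * e \<in> M" for k using submonoid_mult[OF M, of e] G by auto
  show "{m. e dvd m \<or> s * e \<le> m} \<subseteq> M"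
  proof
    fix m assume m: "m \<in> {m. e dvd m \<or> s * e \<le> m}"
    show "m \<in> M"
    proof (cases "e dvd m")
      case True
      then show ?thesis using mult by (auto simp: mult.commute elim: dvdE)
    next
      case False
      then have le: "s \<le> m div e" using m e by (simp add: less_eq_div_iff_mult_less_eq)
      have r: "1 \<le> m mod e" "m mod e \<le> e - 1"
        using False e mod_less_divisor[of e m] unfolding dvd_eq_mod_eq_0 by linarith+
      have "s * e + m mod e \<in> M" using G r by blast
      moreover have "m = (m div e - s) * e + (s * e + m mod e)"
      proof -
        obtain k where "m div e = s + k" using le le_Suc_ex by blast
        then show ?thesis by (metis add.assoc add.commute add_mult_distrib add_diff_cancel_left' div_mult_mod_eq)
      qed
      ultimately show ?thesis using M mult unfolding add_submonoid_def by metis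
    qed
  qed
qed auto

text \<open>
An integer \<open>s \<le> 0\<close> is impossible: \<open>t^(s e + 1)\<close> would be in \<open>R\<close>, but its exponent is negative or equal to 1,
and 1 is not in \<open>H\<close> when \<open>e > 1\<close>.
\<close>

lemma (in numerical_semigroup) adjoin_truncated_progression_iff:
  assumes e: "e \<noteq> 1"
  shows "(\<exists>s::int. (monomial_span H :: 'k::field poly fract set) = k_adjoin
        (insert (t_fract ^ e) {t_fract powi (s * int e + int i) | i. 1 \<le> i \<and> i \<le> e - 1})) \<longleftrightarrow>
      (\<exists>s\<ge>1. H = {m. e dvd m \<or> s * e \<le> m})"
    (is "(\<exists>s. monomial_span H = k_adjoin (?X s)) \<longleftrightarrow> ?R")
proof -
  have e2: "2 \<le> e" using e multiplicity_pos by simp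
  have adjoin: "k_adjoin (?X (int s)) = (monomial_span {m. e dvd m \<or> s * e \<le> m} :: 'k poly fract set)"
    if "1 \<le> s" for s
  proof -
    have "?X (int s) = (\<lambda>a. t_fract ^ a) ` insert e {s * e + i | i. 1 \<le> i \<and> i \<le> e - 1}"
    proof -
      have "t_fract powi (int s * int e + int i) = (t_fract ^ (s * e + i) :: 'k poly fract)" for i
        unfolding of_nat_mult[symmetric] of_nat_add[symmetric] power_int_of_nat ..
      then show ?thesis by auto
    qed
    then show ?thesis
      by (simp only: k_adjoin_monomials submonoid_hull_truncated_progression[OF multiplicity_pos that])
  qed
  show ?thesis
  proof
    assume "\<exists>s. monomial_span H = k_adjoin (?X s)"
    then obtain s where s: "monomial_span H = k_adjoin (?X s)" by blast
    have "t_fract powi (s * int e + int 1) \<in> ?X s" using e2 by force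
    then have "t_fract powi (s * int e + 1) \<in> (monomial_span H :: 'k poly fract set)"
      unfolding s k_adjoin_def by (simp add: hull_inc)
    then have d: "0 \<le> s * int e + 1" "nat (s * int e + 1) \<in> H"
      using homogeneous_mem_monomial_span[of "1 :: 'k" "s * int e + 1" H] by auto
    have "1 \<le> s"
    proof (rule ccontr)
      assume "\<not> 1 \<le> s"
      then consider "s = 0" | "s \<le> -1" by linarith
      then show False
      proof cases
        case 1
        then show False using d(2) multiplicity_le[of 1] e2 by simp
      next
        case 2
        then have "s * int e \<le> -1 * int e" by (intro mult_right_mono) auto
        then show False using d(1) e2 by linarith
      qed
    qed
    then have "1 \<le> nat s" "s = int (nat s)" by auto
    then show ?R using s adjoin[of "nat s"] monomial_span_eq_iff by metis
  next
    assume ?R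
    then obtain s where "1 \<le> s" "H = {m. e dvd m \<or> s * e \<le> m}" by blast
    then have "monomial_span H = k_adjoin (?X (int s))" using adjoin[of s] by simp
    then show "\<exists>s. monomial_span H = k_adjoin (?X s)" by blast
  qed
qed

section \<open>The trace of the first syzygy of the conductor\<close>

theorem theorem1p3:
  fixes as :: "nat list"
    and R :: "'k::field poly fract set"
    and A :: "'k poly fract mat"
    and \<Omega> :: "'k poly fract vec set"
  assumes "numerical_semigroup_gens as"
    and "R = numerical_semigroup_ring as"
    and "min_homogeneous_presentation R (conductor R) A"
    and "is_first_syzygy R (conductor R) \<Omega>"
  shows "trace_ideal R (\<cdot>\<^sub>v) \<Omega> = entry_ideal R A \<and>
    (trace_ideal R (\<cdot>\<^sub>v) \<Omega> = conductor R \<longleftrightarrow>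
     as ! 0 \<noteq> 1 \<and>
     (\<exists>s::int. R = k_adjoin
        (insert (t_fract ^ (as ! 0))
          {t_fract powi (s * int (as ! 0) + int i) | i. 1 \<le> i \<and> i \<le> as ! 0 - 1})))"
proof -
  define H where "H = add_submonoid hull set as"
  obtain c where "numerical_semigroup H (as ! 0) c"
    unfolding H_def by (rule numerical_semigroup_of_gens[OF assms(1)])
  then interpret numerical_semigroup H "as ! 0" c .
  have R: "R = monomial_span H"
    using assms(2) by (simp add: numerical_semigroup_ring_def k_adjoin_monomials H_def)
  have C: "conductor R = monomial_span {c..}"
    unfolding R by (rule conductor_monomial_span)
  have entries: "entry_ideal R A = monomial_span crowded"
  proof -
    obtain g d where min: "min_homogeneous_gens R (conductor R) g d"
      and A: "dim_row A = dim_vec g" "elements_mat A \<subseteq> R"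
        "syzygies R g = {A *\<^sub>v x | x. x \<in> free_module R (dim_col A)}"
      using assms(3) unfolding min_homogeneous_presentation_def by (elim exE conjE) (rule that)
    obtain \<gamma> n where "conductor_generators H (as ! 0) c g \<gamma> n"
      by (rule conductor_generatorsE[OF min[unfolded C, unfolded R]])
    then interpret gens: conductor_generators H "as ! 0" c g \<gamma> n .
    show ?thesis using A unfolding R by (rule gens.entry_ideal_presentation)
  qed
  have trace: "trace_ideal R (\<cdot>\<^sub>v) \<Omega> = monomial_span crowded"
  proof -
    obtain g d where min: "min_homogeneous_gens R (conductor R) g d" and \<Omega>: "\<Omega> = syzygies R g"
      using assms(4) unfolding is_first_syzygy_def by (elim exE conjE) (rule that)
    obtain \<gamma> n where "conductor_generators H (as ! 0) c g \<gamma> n"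
      by (rule conductor_generatorsE[OF min[unfolded C, unfolded R]])
    then interpret gens: conductor_generators H "as ! 0" c g \<gamma> n .
    show ?thesis unfolding \<Omega> R by (rule gens.trace_syzygies)
  qed
  have "trace_ideal R (\<cdot>\<^sub>v) \<Omega> = conductor R \<longleftrightarrow> crowded = {c..}"
    unfolding trace C by (rule monomial_span_eq_iff)
  also have "\<dots> \<longleftrightarrow> as ! 0 \<noteq> 1 \<and>
     (\<exists>s::int. R = k_adjoin
        (insert (t_fract ^ (as ! 0))
          {t_fract powi (s * int (as ! 0) + int i) | i. 1 \<le> i \<and> i \<le> as ! 0 - 1}))"
    unfolding crowded_eq_conductor_iff R
    by (rule conj_cong[OF refl], rule adjoin_truncated_progression_iff[symmetric])
  finally show ?thesis using entries trace by blast
qed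

end
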